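(* Let $\mathcal{H}=(V,E)$ be a finite hypergraph in which every hyperedge has size at least $2$. Let $\mathcal{H}^{[1]}$ denote its $1$-intersection graph. If $\chi(\mathcal{H}^{[1]})=4$, then $\chi(\mathcal{H})\le 4$.
   Context: A hypergraph $\mathcal{H}=(V,E)$ consists of a finite vertex set $V$ and a collection $E$ of subsets of $V$ (hyperedges). A vertex coloring of $\mathcal{H}$ is proper if no hyperedge is monochromatic; $\chi(\mathcal{H})$ is the least number of colors in a proper vertex coloring of $\mathcal{H}$ (which exists since all hyperedges have size at least $2$). The $1$-intersection graph $\mathcal{H}^{[1]}$ of $\mathcal{H}$ is the graph whose vertex set is $E(\mathcal{H})$, in which two distinct hyperedges $e,f$ are adjacent if and only if $|e\cap f|=1$. $\chi(\mathcal{H}^{[1]})$ is the usual chromatic number of this graph. *)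

theory Defs
  imports Main
begin

definition hypergraph :: "'a set \<Rightarrow> 'a set set \<Rightarrow> bool" where
  "hypergraph V E \<longleftrightarrow> finite V \<and> (\<forall>e\<in>E. e \<subseteq> V)"

definition proper_hcoloring :: "'a set \<Rightarrow> 'a set set \<Rightarrow> nat \<Rightarrow> ('a \<Rightarrow> nat) \<Rightarrow> bool" where
  "proper_hcoloring V E k c \<longleftrightarrow>
     (\<forall>v\<in>V. c v < k) \<and> (\<forall>e\<in>E. \<not> (\<exists>i. \<forall>v\<in>e. c v = i))"

definition hchromatic :: "'a set \<Rightarrow> 'a set set \<Rightarrow> nat" where
  "hchromatic V E = (LEAST k. \<exists>c. proper_hcoloring V E k c)"

definition one_int_adj :: "'a set set \<Rightarrow> 'a set \<Rightarrow> 'a set \<Rightarrow> bool" where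
  "one_int_adj E e f \<longleftrightarrow> e \<in> E \<and> f \<in> E \<and> e \<noteq> f \<and> card (e \<inter> f) = 1"

definition proper_gcoloring :: "'b set \<Rightarrow> ('b \<Rightarrow> 'b \<Rightarrow> bool) \<Rightarrow> nat \<Rightarrow> ('b \<Rightarrow> nat) \<Rightarrow> bool" where
  "proper_gcoloring W R k c \<longleftrightarrow>
     (\<forall>w\<in>W. c w < k) \<and> (\<forall>x\<in>W. \<forall>y\<in>W. R x y \<longrightarrow> c x \<noteq> c y)"

definition gchromatic :: "'b set \<Rightarrow> ('b \<Rightarrow> 'b \<Rightarrow> bool) \<Rightarrow> nat" where
  "gchromatic W R = (LEAST k. \<exists>c. proper_gcoloring W R k c)"

definition one_intersection_chromatic :: "'a set set \<Rightarrow> nat" where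
  "one_intersection_chromatic E = gchromatic E (one_int_adj E)"

end

theory Submission
  imports Defs
begin

text \<open>
  A coloring of \<open>\<H>\<^sup>[\<^sup>1\<^sup>]\<close> with 4 colors splits the hyperedges into two halves, each of which has a
  1-intersection graph with only two color classes. It suffices to 2-color the vertices of each
  half, since the product of the two vertex colorings uses 4 colors.

  For two classes, extend a proper 2-coloring \<open>c\<^sub>0\<close> from \<open>V - v\<close> to \<open>v\<close>. If neither color is possible
  for \<open>v\<close>, the edges blocking the first color lie in one class and those blocking the second color
  in the other. Give \<open>v\<close> the first color, and as long as there is a monochromatic edge, flip one of
  its vertices that was not flipped before. The monochromatic edges of the first color always
  lie in one class and those of the second color in the other: an edge that becomes monochromatic
  by a flip meets the edge that caused the flip only in the flipped vertex. No monochromatic edge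
  consists of \<open>v\<close> and flipped vertices only, because it would contradict the choice of \<open>c\<^sub>0\<close> or be a
  blocking edge in the wrong class. Hence the procedure ends with a proper coloring.
\<close>

lemma two_coloring_extend:
  fixes c0 :: "'a \<Rightarrow> bool" and cl :: "'a set \<Rightarrow> bool"
  assumes fin: "finite V"
    and sub: "\<And>e. e \<in> E \<Longrightarrow> e \<subseteq> insert v V"
    and cl: "\<And>e f. \<lbrakk>e \<in> E; f \<in> E; cl e = cl f\<rbrakk> \<Longrightarrow> card (e \<inter> f) \<noteq> 1"
    and c0: "\<And>e b. \<lbrakk>e \<in> E; v \<notin> e\<rbrakk> \<Longrightarrow> \<exists>x\<in>e. c0 x = b"
  shows "\<exists>c :: 'a \<Rightarrow> bool. \<forall>e\<in>E. \<forall>b. \<exists>x\<in>e. c x = b"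
proof (rule ccontr)
  assume none: "\<nexists>c :: 'a \<Rightarrow> bool. \<forall>e\<in>E. \<forall>b. \<exists>x\<in>e. c x = b"
  \<comment> \<open>\<open>blocks b e\<close> says that \<open>e\<close> prevents \<open>v\<close>
    from receiving the color \<open>b\<close>.\<close>
  define blocks where "blocks b e \<longleftrightarrow> e \<in> E \<and> v \<in> e \<and> (\<forall>x\<in>e - {v}. c0 x = b)" for b e
  have ex_blocks: "\<exists>e. blocks b e" for b
  proof -
    obtain e b' where e: "e \<in> E" "\<forall>x\<in>e. (c0(v := b)) x \<noteq> b'"
      using none[unfolded not_ex, THEN spec, of "c0(v := b)"] by blast
    have "v \<in> e"
      using c0[OF e(1), of b'] e(2) by (metis fun_upd_apply)
    moreover from this have "b = (\<not> b')"
      using e(2) by auto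
    ultimately have "blocks b e"
      using e by (auto simp: blocks_def)
    then show ?thesis ..
  qed
  obtain e0 f0 where e0: "blocks True e0" and f0: "blocks False f0"
    using ex_blocks by blast
  have blocks_cl: "cl e \<noteq> cl f" if "blocks True e" "blocks False f" for e f
  proof -
    have "e \<inter> f = {v}"
      using that by (auto simp: blocks_def)
    then show ?thesis
      using cl[of e f] that by (auto simp: blocks_def)
  qed
  define col where "col T x \<longleftrightarrow> (if x = v then True else if x \<in> T then \<not> c0 x else c0 x)" for T x
  define inv where
    "inv T \<longleftrightarrow> (\<forall>g\<in>E. \<forall>b. (\<forall>x\<in>g. col T x = b) \<longrightarrow> (cl g \<longleftrightarrow> cl e0 = b))" for T
  have inv_empty: "inv {}"
    unfolding inv_def
  proof (intro ballI allI impI)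
    fix g b assume g: "g \<in> E" and mono: "\<forall>x\<in>g. col {} x = b"
    have "v \<in> g"
      using c0[OF g, of "\<not> b"] mono by (metis col_def empty_iff)
    then have b: "b"
      using mono by (auto simp: col_def)
    then have "c0 x" if "x \<in> g" "x \<noteq> v" for x
      using mono that by (metis col_def empty_iff)
    then have "blocks True g"
      using g \<open>v \<in> g\<close> by (auto simp: blocks_def)
    \<comment> \<open>There are only two classes, and \<open>g\<close> and \<open>e0\<close> both
      avoid that of \<open>f0\<close>.\<close>
    with b show "cl g \<longleftrightarrow> cl e0 = b"
      using blocks_cl[of g f0] blocks_cl[OF e0 f0] f0 by auto
  qed
  \<comment> \<open>A maximal flipped set satisfying the invariant stands for the end of the
    flipping procedure.\<close>
  obtain T where T: "T \<subseteq> V" "inv T"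
    and maximal: "\<And>T'. \<lbrakk>T' \<subseteq> V; inv T'; T \<subseteq> T'\<rbrakk> \<Longrightarrow> T' = T"
  proof -
    have "finite {T. T \<subseteq> V \<and> inv T}" "{} \<in> {T. T \<subseteq> V \<and> inv T}"
      using fin inv_empty by auto
    from finite_has_maximal2[OF this] obtain T where
      "T \<subseteq> V" "inv T" "\<forall>T'\<in>{T. T \<subseteq> V \<and> inv T}. T \<subseteq> T' \<longrightarrow> T = T'" by blast
    then show ?thesis by (intro that[of T]) blast+
  qed
  obtain g b where g: "g \<in> E" and mono: "\<And>x. x \<in> g \<Longrightarrow> col T x = b"
    using none[unfolded not_ex, THEN spec, of "col T"] by auto
  have clg: "cl g \<longleftrightarrow> cl e0 = b"
    using T(2) g mono by (auto simp: inv_def)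
  have "\<exists>u\<in>g. u \<noteq> v \<and> u \<notin> T"
  proof (rule ccontr)
    assume "\<not> ?thesis"
    then have flipped: "c0 x = (\<not> b)" if "x \<in> g" "x \<noteq> v" for x
      using mono[OF that(1)] that by (auto simp: col_def)
    have v: "v \<in> g"
      using c0[OF g, of b] flipped by metis
    then have b: "b"
      using mono[OF v] by (simp add: col_def)
    then have "blocks False g"
      using g v flipped by (auto simp: blocks_def)
    then show False
      using blocks_cl[OF e0] clg b by auto
  qed
  then obtain u where u: "u \<in> g" "u \<noteq> v" "u \<notin> T" by blast
  have "inv (insert u T)"
    unfolding inv_def
  proof (intro ballI allI impI)
    fix h b' assume h: "h \<in> E" and mono': "\<forall>x\<in>h. col (insert u T) x = b'"
    have same: "col (insert u T) x = col T x" if "x \<noteq> u" for x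
      using that by (auto simp: col_def)
    have flip: "col (insert u T) u \<noteq> col T u"
      using u by (auto simp: col_def)
    show "cl h \<longleftrightarrow> cl e0 = b'"
    proof (cases "u \<in> h")
      case True
      then have b': "b' \<noteq> b"
        using mono' mono[OF u(1)] flip by auto
      have "g \<inter> h = {u}"
      \<comment> \<open>A common vertex has color \<open>b\<close> before the flip and
        \<open>b'\<close> after it, and only \<open>u\<close> changes color.\<close>
      proof (intro equalityI subsetI)
        fix x assume x: "x \<in> g \<inter> h"
        then have "col (insert u T) x \<noteq> col T x"
          using b' mono mono' by auto
        then show "x \<in> {u}"
          using same[of x] by auto
      qed (use True u(1) in auto)
      then have "cl g \<noteq> cl h"
        using cl[OF g h] by auto
      then show ?thesis
        using clg b' by auto
    next
      case False
      then have "\<forall>x\<in>h. col T x = b'"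
        using mono' same by metis
      then show ?thesis
        using T(2) h by (auto simp: inv_def)
    qed
  qed
  moreover have "u \<in> V"
    using sub[OF g] u by auto
  ultimately have "insert u T = T"
    using maximal[of "insert u T"] T(1) by auto
  then show False
    using u by auto
qed

text \<open>Induction on \<open>V\<close>: the edges avoiding the new vertex supply
  \<open>c0\<close>. Singleton edges are excluded by the case \<open>e = f\<close> of the last
  assumption.\<close>

lemma two_coloring_if_two_classes:
  fixes cl :: "'a set \<Rightarrow> bool"
  assumes "finite V"
    and "\<And>e. e \<in> E \<Longrightarrow> e \<subseteq> V"
    and "{} \<notin> E"
    and "\<And>e f. \<lbrakk>e \<in> E; f \<in> E; cl e = cl f\<rbrakk> \<Longrightarrow> card (e \<inter> f) \<noteq> 1"
  shows "\<exists>c :: 'a \<Rightarrow> bool. \<forall>e\<in>E. \<forall>b. \<exists>x\<in>e. c x = b"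
  using assms
proof (induction V arbitrary: E rule: finite_induct)
  case empty
  then have "E = {}"
    by (metis equals0I subset_empty)
  then show ?case by simp
next
  case (insert v V)
  have "\<exists>c :: 'a \<Rightarrow> bool. \<forall>e\<in>{e \<in> E. v \<notin> e}. \<forall>b. \<exists>x\<in>e. c x = b"
    using insert.prems by (intro insert.IH) auto
  then obtain c0 :: "'a \<Rightarrow> bool" where c0: "\<And>e b. \<lbrakk>e \<in> E; v \<notin> e\<rbrakk> \<Longrightarrow> \<exists>x\<in>e. c0 x = b"
    by (metis (mono_tags, lifting) mem_Collect_eq)
  show ?case
    using insert.hyps(1) insert.prems(1,3) c0 by (rule two_coloring_extend)
qed

text \<open>An injective numbering of \<open>W\<close> is a proper coloring, so the
  \<open>LEAST\<close> is attained.\<close>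

lemma gchromatic_coloring:
  assumes "finite W" "\<And>x. x \<in> W \<Longrightarrow> \<not> R x x"
  shows "\<exists>c. proper_gcoloring W R (gchromatic W R) c"
proof -
  obtain h and n :: nat where "h ` W = {i. i < n}" "inj_on h W"
    using finite_imp_inj_to_nat_seg[OF assms(1)] by blast
  then have "proper_gcoloring W R n h"
    using assms(2) by (auto simp: proper_gcoloring_def inj_on_def)
  then have "\<exists>c. proper_gcoloring W R n c" by blast
  then show ?thesis
    unfolding gchromatic_def by (rule LeastI)
qed

theorem theorem1p4:
  fixes V :: "'a set" and E :: "'a set set"
  assumes "hypergraph V E"
    and "\<forall>e\<in>E. card e \<ge> 2"
    and "one_intersection_chromatic E = 4"
  shows "hchromatic V E \<le> 4"
proof -
  have fin: "finite V" and sub: "\<And>e. e \<in> E \<Longrightarrow> e \<subseteq> V"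
    using assms(1) by (auto simp: hypergraph_def)
  have "finite E"
    using fin sub by (meson Pow_iff finite_Pow_iff finite_subset subsetI)
  then obtain k where k: "proper_gcoloring E (one_int_adj E) 4 k"
    using gchromatic_coloring[of E "one_int_adj E"] assms(3)
    by (auto simp: one_intersection_chromatic_def one_int_adj_def)
  have k_less: "k e < 4" if "e \<in> E" for e
    using k that by (simp add: proper_gcoloring_def)
  have k_neq: "k e \<noteq> k f" if "e \<in> E" "f \<in> E" "card (e \<inter> f) = 1" for e f
  proof -
    have "e \<noteq> f"
      using assms(2) that by force
    then show ?thesis
      using k that by (simp add: proper_gcoloring_def one_int_adj_def)
  qed
  \<comment> \<open>The halves have colors 0, 1 and 2, 3; within each, parity determines the
    color.\<close>
  have half: "\<exists>c :: 'a \<Rightarrow> bool. \<forall>e\<in>{e \<in> E. (k e < 2) = s}. \<forall>b. \<exists>x\<in>e. c x = b" for s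
  proof (rule two_coloring_if_two_classes[where V = V and cl = "\<lambda>e. even (k e)"])
    fix e f assume e: "e \<in> {e \<in> E. (k e < 2) = s}" and f: "f \<in> {e \<in> E. (k e < 2) = s}"
      and parity: "even (k e) = even (k f)"
    have "k e \<in> {0, 1, 2, 3}" "k f \<in> {0, 1, 2, 3}"
      using e f k_less[of e] k_less[of f] by auto
    then have "k e = k f"
      using e f parity by auto
    then show "card (e \<inter> f) \<noteq> 1"
      using e f k_neq by blast
  qed (use fin sub assms(2) in auto)
  obtain c d :: "'a \<Rightarrow> bool"
    where c: "\<And>e b. \<lbrakk>e \<in> E; k e < 2\<rbrakk> \<Longrightarrow> \<exists>x\<in>e. c x = b"
      and d: "\<And>e b. \<lbrakk>e \<in> E; \<not> k e < 2\<rbrakk> \<Longrightarrow> \<exists>x\<in>e. d x = b"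
    using half[of True] half[of False] by (metis (mono_tags, lifting) mem_Collect_eq)
  \<comment> \<open>The pair of \<open>c x\<close> and \<open>d x\<close>, read as a binary number
    below 4.\<close>
  define p :: "'a \<Rightarrow> nat" where "p x = 2 * of_bool (c x) + of_bool (d x)" for x
  have p_eq: "c x = c y \<and> d x = d y" if "p x = p y" for x y
    using that by (auto simp: p_def of_bool_def split: if_splits)
  have "proper_hcoloring V E 4 p"
    unfolding proper_hcoloring_def
  proof (intro conjI ballI notI)
    fix e assume e: "e \<in> E" and "\<exists>i. \<forall>x\<in>e. p x = i"
    then have "c x = c y \<and> d x = d y" if "x \<in> e" "y \<in> e" for x y
      using p_eq that by metis
    then show False
      using c[OF e] d[OF e] by metis
  qed (simp add: p_def of_bool_def)
  then show ?thesis
    unfolding hchromatic_def by (intro Least_le exI)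
qed

end
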